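(* (Soundness of $\mathsf{LNIF}$.) For every linear nested sequent $\mathcal{G}$: if $\mathcal{G}$ is derivable in $\mathsf{LNIF}$, then $\Vdash \overline{\forall}\,\iota(\mathcal{G})$, i.e. the universal closure of the interpretation of $\mathcal{G}$ is valid.
   Context: Formulae are built from atomic formulae $p(t_1,\dots,t_n)$ ($p$ an $n$-ary predicate symbol, $n\ge 0$; 0-ary predicates are propositional variables), $\bot$, the connectives $\land,\lor,\supset$ and quantifiers $\forall x,\exists x$. In sequents, bound variables $x,y,\dots$ are syntactically distinct from parameters $a,b,\dots$, which occupy all free positions. $A[a/x]$ is the result of replacing the free occurrences of $x$ in $A$ by $a$; $p(\vec a)$ denotes an atomic formula with parameters $\vec a$. A linear nested sequent is $\Gamma_1\vdash\Delta_1 /\!/ \cdots /\!/ \Gamma_n\vdash\Delta_n$ ($n\ge1$), each $\Gamma_i,\Delta_i$ a finite, possibly empty, multiset of formulae; each $\Gamma_i\vdash\Delta_i$ is a component. In the rule schemas, $\mathcal{G},\mathcal{H},\mathcal{F}$ denote possibly empty sequences of components. The calculus $\mathsf{LNIF}$ has the rules (from premise(s) infer conclusion): Initial: $(id_1)$ $\mathcal{G}/\!/\Gamma,p(\vec a)\vdash p(\vec a),\Delta/\!/\mathcal{H}$; $(id_2)$ $\mathcal{G}/\!/\Gamma_1,p(\vec a)\vdash\Delta_1/\!/\mathcal{H}/\!/\Gamma_2\vdash p(\vec a),\Delta_2/\!/\mathcal{F}$; $(\bot_l)$ $\mathcal{G}/\!/\Gamma,\bot\vdash\Delta/\!/\mathcal{H}$.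 $(\land_l)$: from $\mathcal{G}/\!/\Gamma,A,B\vdash\Delta/\!/\mathcal{H}$ infer $\mathcal{G}/\!/\Gamma,A\land B\vdash\Delta/\!/\mathcal{H}$. $(\lor_r)$: from $\mathcal{G}/\!/\Gamma\vdash\Delta,A,B/\!/\mathcal{H}$ infer $\mathcal{G}/\!/\Gamma\vdash\Delta,A\lor B/\!/\mathcal{H}$. $(\land_r)$: from $\mathcal{G}/\!/\Gamma\vdash\Delta,A/\!/\mathcal{H}$ and $\mathcal{G}/\!/\Gamma\vdash\Delta,B/\!/\mathcal{H}$ infer $\mathcal{G}/\!/\Gamma\vdash\Delta,A\land B/\!/\mathcal{H}$. $(\lor_l)$: from $\mathcal{G}/\!/\Gamma,A\vdash\Delta/\!/\mathcal{H}$ and $\mathcal{G}/\!/\Gamma,B\vdash\Delta/\!/\mathcal{H}$ infer $\mathcal{G}/\!/\Gamma,A\lor B\vdash\Delta/\!/\mathcal{H}$. $(\supset_{r1})$: from $\mathcal{G}/\!/\Gamma\vdash\Delta/\!/A\vdash B$ infer $\mathcal{G}/\!/\Gamma\vdash\Delta,A\supset B$. $(\supset_l)$: from $\mathcal{G}/\!/\Gamma,B\vdash\Delta/\!/\mathcal{H}$ and $\mathcal{G}/\!/\Gamma,A\supset B\vdash A,\Delta/\!/\mathcal{H}$ infer $\mathcal{G}/\!/\Gamma,A\supset B\vdash\Delta/\!/\mathcal{H}$. $(lift)$: from $\mathcal{G}/\!/\Gamma_1,A\vdash\Delta_1/\!/\Gamma_2,A\vdash\Delta_2/\!/\mathcal{H}$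 infer $\mathcal{G}/\!/\Gamma_1,A\vdash\Delta_1/\!/\Gamma_2\vdash\Delta_2/\!/\mathcal{H}$. $(\forall_l)$: from $\mathcal{G}/\!/\Gamma,A[a/x],\forall xA\vdash\Delta/\!/\mathcal{H}$ infer $\mathcal{G}/\!/\Gamma,\forall xA\vdash\Delta/\!/\mathcal{H}$ ($a$ any parameter). $(\forall_{r1})$: from $\mathcal{G}/\!/\Gamma\vdash\Delta/\!/\ \vdash A[a/x]$ infer $\mathcal{G}/\!/\Gamma\vdash\Delta,\forall xA$. $(\exists_l)$: from $\mathcal{G}/\!/\Gamma,A[a/x]\vdash\Delta/\!/\mathcal{H}$ infer $\mathcal{G}/\!/\Gamma,\exists xA\vdash\Delta/\!/\mathcal{H}$. $(\exists_r)$: from $\mathcal{G}/\!/\Gamma\vdash A[a/x],\exists xA,\Delta/\!/\mathcal{H}$ infer $\mathcal{G}/\!/\Gamma\vdash\exists xA,\Delta/\!/\mathcal{H}$ ($a$ any parameter). $(\supset_{r2})$: from $\mathcal{G}/\!/\Gamma_1\vdash\Delta_1/\!/A\vdash B/\!/\Gamma_2\vdash\Delta_2/\!/\mathcal{H}$ and $\mathcal{G}/\!/\Gamma_1\vdash\Delta_1/\!/\Gamma_2\vdash\Delta_2,A\supset B/\!/\mathcal{H}$ infer $\mathcal{G}/\!/\Gamma_1\vdash\Delta_1,A\supset B/\!/\Gamma_2\vdash\Delta_2/\!/\mathcal{H}$. $(\forall_{r2})$: from $\mathcal{G}/\!/\Gamma_1\vdash\Delta_1/\!/\ \vdash A[a/x]/\!/\Gamma_2\vdash\Delta_2/\!/\mathcal{H}$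 and $\mathcal{G}/\!/\Gamma_1\vdash\Delta_1/\!/\Gamma_2\vdash\Delta_2,\forall xA/\!/\mathcal{H}$ infer $\mathcal{G}/\!/\Gamma_1\vdash\Delta_1,\forall xA/\!/\Gamma_2\vdash\Delta_2/\!/\mathcal{H}$. In $(\forall_{r1}),(\exists_l),(\forall_{r2})$ the parameter $a$ is an eigenvariable: it does not occur in the conclusion. Derivations are finite trees of rule instances with initial rules at the leaves. Semantics: a relational frame is $(W,R,D)$ with $W\neq\emptyset$, $R$ a reflexive, transitive, antisymmetric and connected (if $Rwu$ and $Rwv$ then $Ruv$ or $Rvu$) relation on $W$, and $D$ assigning each $w$ a non-empty domain $D_w$ with $D_w=D_u$ whenever $Rwu$. A model adds a valuation $V$ with $V(p,w)\subseteq (D_w)^n$ for $n$-ary $p$ (for $n=0$, whether $p$ is true at $w$), monotone along $R$. For sentences with parameters from $D_w$: $w\not\Vdash\bot$; $w\Vdash p(\vec a)$ iff $\vec a\in V(p,w)$; $\land,\lor$ pointwise; $w\Vdash A\supset B$ iff for all $u$ with $Rwu$, $u\Vdash A$ implies $u\Vdash B$; $w\Vdash\forall xA$ iff for all $u$ with $Rwu$ and all $c\in D_u$, $u\Vdash A[c/x]$; $w\Vdash\exists xA$ iff $w\Vdash A[c/x]$ for some $c\in D_w$. A formula $A$ is valid ($\Vdash A$) iff in every model, every world satisfies the universal closure $\overline{\forall}A$ (all free variables/parameters universally quantified). Interpretation: $\iota(\Gamma\vdash\Delta)=\bigwedge\Gamma\supset\bigvee\Delta$ and $\iota(\Gamma\vdash\Delta/\!/\mathcal{G})=\bigwedge\Gamma\supset(\bigvee\Delta\lor\iota(\mathcal{G}))$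 (empty conjunction is $\top$, i.e. $\bot\supset\bot$, empty disjunction is $\bot$); $\overline{\forall}\iota(\mathcal{G})$ universally quantifies all parameters. *)

theory Defs
  imports "HOL-Library.Multiset"
begin

section \<open>Formulae\<close>

text \<open>
  Variables (which may be bound) and parameters are syntactically distinct. The type of parameters
  is left open: sequents use \<open>nat\<close>, whereas forcing takes the elements of the domains of a
  model as parameters.
\<close>

datatype (pars_trm: 'a) trm = Var nat | Par 'a

datatype (preds_fm: 'p, pars_fm: 'a) fm =
    Atom 'p "'a trm list"
  | Bot
  | And "('p, 'a) fm" "('p, 'a) fm"
  | Or "('p, 'a) fm" "('p, 'a) fm"
  | Imp "('p, 'a) fm" "('p, 'a) fm"
  | All nat "('p, 'a) fm"
  | Ex nat "('p, 'a) fm"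

fun vars_trm :: "'a trm \<Rightarrow> nat set" where
  "vars_trm (Var x) = {x}"
| "vars_trm (Par a) = {}"

text \<open>All variables of a formula, whether free, bound, or merely following a quantifier symbol.\<close>

primrec vars_fm :: "('p, 'a) fm \<Rightarrow> nat set" where
  "vars_fm (Atom p ts) = (\<Union>t\<in>set ts. vars_trm t)"
| "vars_fm Bot = {}"
| "vars_fm (And A B) = vars_fm A \<union> vars_fm B"
| "vars_fm (Or A B) = vars_fm A \<union> vars_fm B"
| "vars_fm (Imp A B) = vars_fm A \<union> vars_fm B"
| "vars_fm (All x A) = insert x (vars_fm A)"
| "vars_fm (Ex x A) = insert x (vars_fm A)"

primrec fv_fm :: "('p, 'a) fm \<Rightarrow> nat set" where
  "fv_fm (Atom p ts) = (\<Union>t\<in>set ts. vars_trm t)"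
| "fv_fm Bot = {}"
| "fv_fm (And A B) = fv_fm A \<union> fv_fm B"
| "fv_fm (Or A B) = fv_fm A \<union> fv_fm B"
| "fv_fm (Imp A B) = fv_fm A \<union> fv_fm B"
| "fv_fm (All x A) = fv_fm A - {x}"
| "fv_fm (Ex x A) = fv_fm A - {x}"

text \<open>\<open>wf_fm ar A\<close>: every predicate symbol is applied to as many terms as its arity says.\<close>

primrec wf_fm :: "('p \<Rightarrow> nat) \<Rightarrow> ('p, 'a) fm \<Rightarrow> bool" where
  "wf_fm ar (Atom p ts) \<longleftrightarrow> length ts = ar p"
| "wf_fm ar Bot \<longleftrightarrow> True"
| "wf_fm ar (And A B) \<longleftrightarrow> wf_fm ar A \<and> wf_fm ar B"
| "wf_fm ar (Or A B) \<longleftrightarrow> wf_fm ar A \<and> wf_fm ar B"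
| "wf_fm ar (Imp A B) \<longleftrightarrow> wf_fm ar A \<and> wf_fm ar B"
| "wf_fm ar (All x A) \<longleftrightarrow> wf_fm ar A"
| "wf_fm ar (Ex x A) \<longleftrightarrow> wf_fm ar A"

text \<open>\<open>inst_fm a x A\<close> is $A[a/x]$; parameters are never bound, so nothing can be captured.\<close>

fun inst_trm :: "'a \<Rightarrow> nat \<Rightarrow> 'a trm \<Rightarrow> 'a trm" where
  "inst_trm a x (Var y) = (if y = x then Par a else Var y)"
| "inst_trm a x (Par b) = Par b"

primrec inst_fm :: "'a \<Rightarrow> nat \<Rightarrow> ('p, 'a) fm \<Rightarrow> ('p, 'a) fm" where
  "inst_fm a x (Atom p ts) = Atom p (map (inst_trm a x) ts)"
| "inst_fm a x Bot = Bot"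
| "inst_fm a x (And A B) = And (inst_fm a x A) (inst_fm a x B)"
| "inst_fm a x (Or A B) = Or (inst_fm a x A) (inst_fm a x B)"
| "inst_fm a x (Imp A B) = Imp (inst_fm a x A) (inst_fm a x B)"
| "inst_fm a x (All y A) = All y (if y = x then A else inst_fm a x A)"
| "inst_fm a x (Ex y A) = Ex y (if y = x then A else inst_fm a x A)"

section \<open>Universal closure\<close>

text \<open>
  \<open>gen_fm a x A\<close> puts the variable \<open>x\<close> for the parameter \<open>a\<close>. It is used with an \<open>x\<close> that is not
  in \<open>vars_fm A\<close>, so that no quantifier of \<open>A\<close> captures the new occurrences.
\<close>

fun gen_trm :: "'a \<Rightarrow> nat \<Rightarrow> 'a trm \<Rightarrow> 'a trm" where
  "gen_trm a x (Var y) = Var y"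
| "gen_trm a x (Par b) = (if b = a then Var x else Par b)"

primrec gen_fm :: "'a \<Rightarrow> nat \<Rightarrow> ('p, 'a) fm \<Rightarrow> ('p, 'a) fm" where
  "gen_fm a x (Atom p ts) = Atom p (map (gen_trm a x) ts)"
| "gen_fm a x Bot = Bot"
| "gen_fm a x (And A B) = And (gen_fm a x A) (gen_fm a x B)"
| "gen_fm a x (Or A B) = Or (gen_fm a x A) (gen_fm a x B)"
| "gen_fm a x (Imp A B) = Imp (gen_fm a x A) (gen_fm a x B)"
| "gen_fm a x (All y A) = All y (gen_fm a x A)"
| "gen_fm a x (Ex y A) = Ex y (gen_fm a x A)"

definition all_par :: "'a \<Rightarrow> ('p, 'a) fm \<Rightarrow> ('p, 'a) fm" where
  "all_par a A = (let x = LEAST x. x \<notin> vars_fm A in All x (gen_fm a x A))"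

text \<open>The free variables are quantified first (innermost), then the parameters.\<close>

definition univ_closure :: "('p, nat) fm \<Rightarrow> ('p, nat) fm" where
  "univ_closure A =
     foldr all_par (sorted_list_of_set (pars_fm A))
       (foldr All (sorted_list_of_set (fv_fm A)) A)"

section \<open>Linear nested sequents and their interpretation\<close>

datatype 'p comp =
  Comp (ante: "('p, nat) fm multiset") (succ: "('p, nat) fm multiset")  (infix "\<turnstile>" 50)

type_synonym 'p lns = "'p comp list"

definition fms_comp :: "'p comp \<Rightarrow> ('p, nat) fm set" where
  "fms_comp c = set_mset (ante c) \<union> set_mset (succ c)"

definition fms_lns :: "'p lns \<Rightarrow> ('p, nat) fm set" where
  "fms_lns G = (\<Union>c\<in>set G. fms_comp c)"

definition pars_lns :: "'p lns \<Rightarrow> nat set" where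
  "pars_lns G = (\<Union>A\<in>fms_lns G. pars_fm A)"

text \<open>At least one component, and parameters in all free positions.\<close>

definition is_lns :: "('p \<Rightarrow> nat) \<Rightarrow> 'p lns \<Rightarrow> bool" where
  "is_lns ar G \<longleftrightarrow> G \<noteq> [] \<and> (\<forall>A\<in>fms_lns G. wf_fm ar A \<and> fv_fm A = {})"

definition Top :: "('p, 'a) fm" where
  "Top = Imp Bot Bot"

fun conj_list :: "('p, 'a) fm list \<Rightarrow> ('p, 'a) fm" where
  "conj_list [] = Top"
| "conj_list [A] = A"
| "conj_list (A # B # As) = And A (conj_list (B # As))"

fun disj_list :: "('p, 'a) fm list \<Rightarrow> ('p, 'a) fm" where
  "disj_list [] = Bot"
| "disj_list [A] = A"
| "disj_list (A # B # As) = Or A (disj_list (B # As))"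

text \<open>
  The conjunction and the disjunction of a finite multiset list its elements, with repetitions,
  in some arbitrary but fixed order.
\<close>

definition big_conj :: "('p, 'a) fm multiset \<Rightarrow> ('p, 'a) fm" where
  "big_conj \<Gamma> = conj_list (SOME As. mset As = \<Gamma>)"

definition big_disj :: "('p, 'a) fm multiset \<Rightarrow> ('p, 'a) fm" where
  "big_disj \<Gamma> = disj_list (SOME As. mset As = \<Gamma>)"

text \<open>The first equation is a dummy: the empty list is not a linear nested sequent.\<close>

fun interp :: "'p lns \<Rightarrow> ('p, nat) fm" where
  "interp [] = Bot"
| "interp [\<Gamma> \<turnstile> \<Delta>] = Imp (big_conj \<Gamma>) (big_disj \<Delta>)"
| "interp ((\<Gamma> \<turnstile> \<Delta>) # c # G) = Imp (big_conj \<Gamma>) (Or (big_disj \<Delta>) (interp (c # G)))"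

section \<open>The calculus\<close>

text \<open>
  The rules do not mention \<open>is_lns\<close>: read from the conclusion to the premises, they preserve it,
  so all sequents in a derivation of a linear nested sequent are linear nested sequents.
\<close>

inductive LNIF :: "'p lns \<Rightarrow> bool" where
  id1: "LNIF (G @ (add_mset (Atom p (map Par as)) \<Gamma> \<turnstile> add_mset (Atom p (map Par as)) \<Delta>) # H)"
| id2: "LNIF (G @ (add_mset (Atom p (map Par as)) \<Gamma>\<^sub>1 \<turnstile> \<Delta>\<^sub>1) # H
               @ (\<Gamma>\<^sub>2 \<turnstile> add_mset (Atom p (map Par as)) \<Delta>\<^sub>2) # F)"
| bot_l: "LNIF (G @ (add_mset Bot \<Gamma> \<turnstile> \<Delta>) # H)"
| and_l: "LNIF (G @ (add_mset A (add_mset B \<Gamma>) \<turnstile> \<Delta>) # H) \<Longrightarrow>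
    LNIF (G @ (add_mset (And A B) \<Gamma> \<turnstile> \<Delta>) # H)"
| or_r: "LNIF (G @ (\<Gamma> \<turnstile> add_mset A (add_mset B \<Delta>)) # H) \<Longrightarrow>
    LNIF (G @ (\<Gamma> \<turnstile> add_mset (Or A B) \<Delta>) # H)"
| and_r: "LNIF (G @ (\<Gamma> \<turnstile> add_mset A \<Delta>) # H) \<Longrightarrow> LNIF (G @ (\<Gamma> \<turnstile> add_mset B \<Delta>) # H) \<Longrightarrow>
    LNIF (G @ (\<Gamma> \<turnstile> add_mset (And A B) \<Delta>) # H)"
| or_l: "LNIF (G @ (add_mset A \<Gamma> \<turnstile> \<Delta>) # H) \<Longrightarrow> LNIF (G @ (add_mset B \<Gamma> \<turnstile> \<Delta>) # H) \<Longrightarrow>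
    LNIF (G @ (add_mset (Or A B) \<Gamma> \<turnstile> \<Delta>) # H)"
| imp_r1: "LNIF (G @ [\<Gamma> \<turnstile> \<Delta>, {#A#} \<turnstile> {#B#}]) \<Longrightarrow>
    LNIF (G @ [\<Gamma> \<turnstile> add_mset (Imp A B) \<Delta>])"
| imp_l: "LNIF (G @ (add_mset B \<Gamma> \<turnstile> \<Delta>) # H) \<Longrightarrow>
    LNIF (G @ (add_mset (Imp A B) \<Gamma> \<turnstile> add_mset A \<Delta>) # H) \<Longrightarrow>
    LNIF (G @ (add_mset (Imp A B) \<Gamma> \<turnstile> \<Delta>) # H)"
| lift: "LNIF (G @ (add_mset A \<Gamma>\<^sub>1 \<turnstile> \<Delta>\<^sub>1) # (add_mset A \<Gamma>\<^sub>2 \<turnstile> \<Delta>\<^sub>2) # H) \<Longrightarrow>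
    LNIF (G @ (add_mset A \<Gamma>\<^sub>1 \<turnstile> \<Delta>\<^sub>1) # (\<Gamma>\<^sub>2 \<turnstile> \<Delta>\<^sub>2) # H)"
| all_l: "LNIF (G @ (add_mset (inst_fm a x A) (add_mset (All x A) \<Gamma>) \<turnstile> \<Delta>) # H) \<Longrightarrow>
    LNIF (G @ (add_mset (All x A) \<Gamma> \<turnstile> \<Delta>) # H)"
| all_r1: "LNIF (G @ [\<Gamma> \<turnstile> \<Delta>, {#} \<turnstile> {#inst_fm a x A#}]) \<Longrightarrow>
    a \<notin> pars_lns (G @ [\<Gamma> \<turnstile> add_mset (All x A) \<Delta>]) \<Longrightarrow>
    LNIF (G @ [\<Gamma> \<turnstile> add_mset (All x A) \<Delta>])"
| ex_l: "LNIF (G @ (add_mset (inst_fm a x A) \<Gamma> \<turnstile> \<Delta>) # H) \<Longrightarrow>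
    a \<notin> pars_lns (G @ (add_mset (Ex x A) \<Gamma> \<turnstile> \<Delta>) # H) \<Longrightarrow>
    LNIF (G @ (add_mset (Ex x A) \<Gamma> \<turnstile> \<Delta>) # H)"
| ex_r: "LNIF (G @ (\<Gamma> \<turnstile> add_mset (inst_fm a x A) (add_mset (Ex x A) \<Delta>)) # H) \<Longrightarrow>
    LNIF (G @ (\<Gamma> \<turnstile> add_mset (Ex x A) \<Delta>) # H)"
| imp_r2: "LNIF (G @ (\<Gamma>\<^sub>1 \<turnstile> \<Delta>\<^sub>1) # ({#A#} \<turnstile> {#B#}) # (\<Gamma>\<^sub>2 \<turnstile> \<Delta>\<^sub>2) # H) \<Longrightarrow>
    LNIF (G @ (\<Gamma>\<^sub>1 \<turnstile> \<Delta>\<^sub>1) # (\<Gamma>\<^sub>2 \<turnstile> add_mset (Imp A B) \<Delta>\<^sub>2) # H) \<Longrightarrow>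
    LNIF (G @ (\<Gamma>\<^sub>1 \<turnstile> add_mset (Imp A B) \<Delta>\<^sub>1) # (\<Gamma>\<^sub>2 \<turnstile> \<Delta>\<^sub>2) # H)"
| all_r2: "LNIF (G @ (\<Gamma>\<^sub>1 \<turnstile> \<Delta>\<^sub>1) # ({#} \<turnstile> {#inst_fm a x A#}) # (\<Gamma>\<^sub>2 \<turnstile> \<Delta>\<^sub>2) # H) \<Longrightarrow>
    LNIF (G @ (\<Gamma>\<^sub>1 \<turnstile> \<Delta>\<^sub>1) # (\<Gamma>\<^sub>2 \<turnstile> add_mset (All x A) \<Delta>\<^sub>2) # H) \<Longrightarrow>
    a \<notin> pars_lns (G @ (\<Gamma>\<^sub>1 \<turnstile> add_mset (All x A) \<Delta>\<^sub>1) # (\<Gamma>\<^sub>2 \<turnstile> \<Delta>\<^sub>2) # H) \<Longrightarrow>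
    LNIF (G @ (\<Gamma>\<^sub>1 \<turnstile> add_mset (All x A) \<Delta>\<^sub>1) # (\<Gamma>\<^sub>2 \<turnstile> \<Delta>\<^sub>2) # H)"

section \<open>Semantics\<close>

record ('w, 'd) frame =
  worlds :: "'w set"
  acc_rel :: "('w \<times> 'w) set"
  dmn :: "'w \<Rightarrow> 'd set"

record ('w, 'd, 'p) model = "('w, 'd) frame" +
  val :: "'p \<Rightarrow> 'w \<Rightarrow> 'd list set"

definition is_frame :: "('w, 'd, 'z) frame_scheme \<Rightarrow> bool" where
  "is_frame F \<longleftrightarrow>
     worlds F \<noteq> {} \<and>
     partial_order_on (worlds F) (acc_rel F) \<and>
     (\<forall>w u v. (w, u) \<in> acc_rel F \<and> (w, v) \<in> acc_rel F \<longrightarrow>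
        (u, v) \<in> acc_rel F \<or> (v, u) \<in> acc_rel F) \<and>
     (\<forall>w\<in>worlds F. dmn F w \<noteq> {}) \<and>
     (\<forall>w u. (w, u) \<in> acc_rel F \<longrightarrow> dmn F w = dmn F u)"

text \<open>For a 0-ary \<open>p\<close>, truth of \<open>p\<close> at \<open>w\<close> is \<open>[] \<in> val M p w\<close>.\<close>

definition is_model :: "('p \<Rightarrow> nat) \<Rightarrow> ('w, 'd, 'p) model \<Rightarrow> bool" where
  "is_model ar M \<longleftrightarrow>
     is_frame M \<and>
     (\<forall>p. \<forall>w\<in>worlds M. val M p w \<subseteq> {cs. length cs = ar p \<and> set cs \<subseteq> dmn M w}) \<and>
     (\<forall>p w u. (w, u) \<in> acc_rel M \<longrightarrow> val M p w \<subseteq> val M p u)"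

primrec depth :: "('p, 'a) fm \<Rightarrow> nat" where
  "depth (Atom p ts) = 0"
| "depth Bot = 0"
| "depth (And A B) = Suc (max (depth A) (depth B))"
| "depth (Or A B) = Suc (max (depth A) (depth B))"
| "depth (Imp A B) = Suc (max (depth A) (depth B))"
| "depth (All x A) = Suc (depth A)"
| "depth (Ex x A) = Suc (depth A)"

lemma depth_inst_fm [simp]: "depth (inst_fm a x A) = depth A"
  by (induction A) auto

text \<open>
  Intended for formulae \<open>A\<close> without free variables whose parameters belong to the domain
  of \<open>w\<close>.
\<close>

function forces :: "('w, 'd, 'p) model \<Rightarrow> 'w \<Rightarrow> ('p, 'd) fm \<Rightarrow> bool" where
  "forces M w (Atom p ts) \<longleftrightarrow> (\<exists>cs. ts = map Par cs \<and> cs \<in> val M p w)"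
| "forces M w Bot \<longleftrightarrow> False"
| "forces M w (And A B) \<longleftrightarrow> forces M w A \<and> forces M w B"
| "forces M w (Or A B) \<longleftrightarrow> forces M w A \<or> forces M w B"
| "forces M w (Imp A B) \<longleftrightarrow> (\<forall>u. (w, u) \<in> acc_rel M \<longrightarrow> forces M u A \<longrightarrow> forces M u B)"
| "forces M w (All x A) \<longleftrightarrow>
     (\<forall>u. (w, u) \<in> acc_rel M \<longrightarrow> (\<forall>c\<in>dmn M u. forces M u (inst_fm c x A)))"
| "forces M w (Ex x A) \<longleftrightarrow> (\<exists>c\<in>dmn M w. forces M w (inst_fm c x A))"
  by pat_completeness auto
termination
  by (relation "measure (\<lambda>(M, w, A). depth A)") auto

text \<open>
  \<open>TYPE('w)\<close> and \<open>TYPE('d)\<close> are the types from which worlds and domain elements are drawn;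
  validity proper is validity for all choices of them. A universal closure has no parameters, so
  \<open>map_fm\<close> merely moves it to the type of formulae with parameters from the domains, and the
  function given to it is irrelevant.
\<close>

definition valid :: "'w itself \<Rightarrow> 'd itself \<Rightarrow> ('p \<Rightarrow> nat) \<Rightarrow> ('p, nat) fm \<Rightarrow> bool" where
  "valid (_ :: 'w itself) (_ :: 'd itself) ar A \<longleftrightarrow>
     (\<forall>M :: ('w, 'd, 'p) model. is_model ar M \<longrightarrow>
        (\<forall>w\<in>worlds M. forces M w (map_fm id (\<lambda>_. undefined) (univ_closure A))))"

end

theory Submission
  imports Defs
begin

text \<open>
  Read contrapositively, a nested sequent fails at a world \<open>w\<close> when there is an ascending chain of
  worlds above \<open>w\<close>, one per component, each of which forces the antecedent and nothing in the
  succedent of its component. A rule is sound if such a chain for the conclusion yields one for some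
  premise. Since frames are connected, the world witnessing the failure of an implication or of a
  universal formula in one component can be compared with the world of the next component: it
  either fits between the two, or lies above the second and the formula fails there as well. These
  are the two premises of \<open>imp_r2\<close> and of \<open>all_r2\<close>. Constancy of the domains makes every parameter
  interpretable at every world of the chain.
\<close>

section \<open>Substitution and renaming of parameters\<close>

lemma map_fm_inst: "map_fm f h (inst_fm a x A) = inst_fm (h a) x (map_fm f h A)"
proof (induction A)
  case (Atom p ts)
  have "map_trm h (inst_trm a x t) = inst_trm (h a) x (map_trm h t)" for t
    by (cases t) auto
  then show ?case
    by simp
qed auto

lemma map_fm_cong_pars:
  "(\<And>a. a \<in> pars_fm A \<Longrightarrow> h a = h' a) \<Longrightarrow> map_fm f h A = map_fm f h' A"
  by (rule fm.map_cong0) auto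

text \<open>As \<open>x\<close> occurs nowhere in \<open>A\<close>, not even bound, instantiation
  hits just the places that \<open>gen_fm\<close> created. Quantifying over \<open>a\<close> thus
  becomes updating its value.\<close>

lemma inst_map_gen:
  "x \<notin> vars_fm A \<Longrightarrow> inst_fm c x (map_fm f h (gen_fm a x A)) = map_fm f (h(a := c)) A"
proof (induction A)
  case (Atom p ts)
  have "inst_trm c x (map_trm h (gen_trm a x t)) = map_trm (h(a := c)) t" if "t \<in> set ts" for t
    using Atom that by (cases t) auto
  then show ?case
    by (auto simp: fun_upd_def)
qed (auto simp: fun_upd_def)

lemma finite_vars_fm: "finite (vars_fm A)"
proof (induction A)
  case (Atom p ts)
  have "finite (vars_trm t)" for t :: "'b trm"
    by (cases t) auto
  then show ?case
    by simp
qed auto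

lemma finite_pars_fm: "finite (pars_fm A)"
proof (induction A)
  case (Atom p ts)
  have "finite (pars_trm t)" for t :: "'b trm"
    by (cases t) auto
  then show ?case
    by simp
qed auto

lemma fresh_var: "(LEAST x. x \<notin> vars_fm A) \<notin> vars_fm A"
  using ex_new_if_finite[OF infinite_UNIV_nat finite_vars_fm] by (rule LeastI_ex)

lemma fv_gen_fm: "fv_fm (gen_fm a x A) \<subseteq> insert x (fv_fm A)"
proof (induction A)
  case (Atom p ts)
  have "vars_trm (gen_trm a x t) \<subseteq> insert x (vars_trm t)" for t
    by (cases t) auto
  then show ?case
    by fastforce
qed auto

lemma fv_all_par: "fv_fm (all_par a A) \<subseteq> fv_fm A"
  using fv_gen_fm by (fastforce simp: all_par_def Let_def)

lemma fv_foldr_all_par: "fv_fm (foldr all_par ps A) \<subseteq> fv_fm A"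
  by (induction ps) (use fv_all_par in fastforce)+

lemma univ_closure_closed:
  "fv_fm A = {} \<Longrightarrow> univ_closure A = foldr all_par (sorted_list_of_set (pars_fm A)) A"
  by (simp add: univ_closure_def)

text \<open>Validity closes a formula that the theorem has already closed; this lets the second
  closure be treated like the first.\<close>

lemma fv_univ_closure: "fv_fm A = {} \<Longrightarrow> fv_fm (univ_closure A) = {}"
  using fv_foldr_all_par[of _ A] by (simp add: univ_closure_closed)

section \<open>Closed formulae and interpretations of sequents\<close>

lemma fv_conj_list: "fv_fm (conj_list As) = (\<Union>A\<in>set As. fv_fm A)"
  by (induction As rule: conj_list.induct) (auto simp: Top_def)

lemma fv_disj_list: "fv_fm (disj_list As) = (\<Union>A\<in>set As. fv_fm A)"
  by (induction As rule: disj_list.induct) auto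

lemma mset_some_list: "mset (SOME As. mset As = \<Gamma>) = \<Gamma>"
  using ex_mset by (rule someI_ex)

lemma set_some_list: "set (SOME As. mset As = \<Gamma>) = set_mset \<Gamma>"
  by (metis mset_some_list set_mset_mset)

lemma fv_interp: "fv_fm (interp G) = (\<Union>A\<in>fms_lns G. fv_fm A)"
  by (induction G rule: interp.induct)
    (auto simp: fms_lns_def fms_comp_def big_conj_def big_disj_def fv_conj_list fv_disj_list
      set_some_list)

lemma pars_lns_simps [simp]:
  "pars_lns [] = {}"
  "pars_lns ((\<Gamma> \<turnstile> \<Delta>) # G) =
     (\<Union>A\<in>set_mset \<Gamma>. pars_fm A) \<union> (\<Union>A\<in>set_mset \<Delta>. pars_fm A) \<union> pars_lns G"
  "pars_lns (G @ H) = pars_lns G \<union> pars_lns H"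
  by (auto simp: pars_lns_def fms_lns_def fms_comp_def)

section \<open>Forcing and soundness of the rules\<close>

locale lin_model =
  fixes ar :: "'p \<Rightarrow> nat" and M :: "('w, 'd, 'p) model"
  assumes model: "is_model ar M"
begin

section \<open>Frame conditions and persistence of forcing\<close>

abbreviation le :: "'w \<Rightarrow> 'w \<Rightarrow> bool" (infix "\<preceq>" 50) where
  "w \<preceq> u \<equiv> (w, u) \<in> acc_rel M"

lemma porder: "partial_order_on (worlds M) (acc_rel M)"
  using model by (simp add: is_model_def is_frame_def)

lemma le_refl: "w \<in> worlds M \<Longrightarrow> w \<preceq> w"
  using porder by (auto simp: partial_order_on_def preorder_on_def refl_on_def)

lemma le_trans: "w \<preceq> u \<Longrightarrow> u \<preceq> v \<Longrightarrow> w \<preceq> v"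
  using porder by (auto simp: partial_order_on_def preorder_on_def dest: transD)

lemma le_worlds: "w \<preceq> u \<Longrightarrow> u \<in> worlds M"
  using porder by (auto simp: partial_order_on_def preorder_on_def refl_on_def)

lemma le_connected: "w \<preceq> u \<Longrightarrow> w \<preceq> v \<Longrightarrow> u \<preceq> v \<or> v \<preceq> u"
  using model unfolding is_model_def is_frame_def by blast

lemma le_dmn: "w \<preceq> u \<Longrightarrow> dmn M u = dmn M w"
  using model unfolding is_model_def is_frame_def by metis

lemma dmn_nonempty: "w \<in> worlds M \<Longrightarrow> dmn M w \<noteq> {}"
  using model unfolding is_model_def is_frame_def by blast

lemma val_mono: "w \<preceq> u \<Longrightarrow> val M p w \<subseteq> val M p u"
  using model unfolding is_model_def by blast

text \<open>Induction is on depth because an instance is not a subformula but has the depth of its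
  body. Implication and universal quantifier need only transitivity; an existential witness stays
  available since domains are constant.\<close>

lemma forces_mono: "forces M w A \<Longrightarrow> w \<preceq> u \<Longrightarrow> forces M u A"
proof (induction A rule: measure_induct_rule[of depth])
  case (less A)
  show ?case
  proof (cases A)
    case (Atom p ts)
    then show ?thesis
      using less.prems val_mono by fastforce
  next
    case (And B C)
    then show ?thesis
      using less by auto
  next
    case (Or B C)
    then show ?thesis
      using less by auto
  next
    case (Imp B C)
    then show ?thesis
      using less.prems le_trans by fastforce
  next
    case (All x B)
    then show ?thesis
      using less.prems le_trans by fastforce
  next
    case (Ex x B)
    with less.prems obtain c where "c \<in> dmn M w" "forces M w (inst_fm c x B)"
      by auto
    moreover from this(2) have "forces M u (inst_fm c x B)"
      by (rule less.IH[rotated]) (use Ex less.prems in auto)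
    ultimately show ?thesis
      using Ex le_dmn less.prems(2) by auto
  qed (use less.prems in simp)
qed

section \<open>Failure of sequents along ascending chains\<close>

abbreviation sat :: "(nat \<Rightarrow> 'd) \<Rightarrow> 'w \<Rightarrow> ('p, nat) fm \<Rightarrow> bool" where
  "sat h w A \<equiv> forces M w (map_fm id h A)"

text \<open>The empty list fails at every world, so that \<open>fails\<close> also applies to the
  suffixes and contexts into which a rule splits a sequent.\<close>

fun fails :: "(nat \<Rightarrow> 'd) \<Rightarrow> 'w \<Rightarrow> 'p lns \<Rightarrow> bool" where
  "fails h w [] \<longleftrightarrow> True"
| "fails h w ((\<Gamma> \<turnstile> \<Delta>) # G) \<longleftrightarrow>
     (\<exists>u. w \<preceq> u \<and> (\<forall>A\<in>#\<Gamma>. sat h u A) \<and> (\<forall>B\<in>#\<Delta>. \<not> sat h u B) \<and> fails h u G)"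

lemma fails_cong:
  "\<forall>a\<in>pars_lns G. h' a = h a \<Longrightarrow> fails h' w G \<longleftrightarrow> fails h w G"
proof (induction G arbitrary: w)
  case (Cons c G)
  obtain \<Gamma> \<Delta> where c: "c = (\<Gamma> \<turnstile> \<Delta>)"
    by (cases c)
  have "map_fm id h' A = map_fm id h A" if "A \<in># \<Gamma> \<or> A \<in># \<Delta>" for A
    using that Cons.prems
    by (intro map_fm_cong_pars) (auto simp: c)
  moreover have "fails h' u G \<longleftrightarrow> fails h u G" for u
    using Cons.prems by (intro Cons.IH) (auto simp: c)
  ultimately show ?case
    by (simp add: c)
qed simp

text \<open>
  The last clause allows the suffix \<open>X\<close> to be exchanged, and the interpretation of eigenvariables to
  be changed at the same time.
\<close>

lemma fails_appendE:
  assumes "fails h w (G @ X)" and "w \<in> worlds M"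
  obtains u where "w \<preceq> u" and "fails h u X"
    and "\<And>h' Y. \<forall>a\<in>pars_lns G. h' a = h a \<Longrightarrow> fails h' u Y \<Longrightarrow> fails h' w (G @ Y)"
proof -
  have "\<exists>u. w \<preceq> u \<and> fails h u X \<and>
      (\<forall>h' Y. (\<forall>a\<in>pars_lns G. h' a = h a) \<longrightarrow> fails h' u Y \<longrightarrow> fails h' w (G @ Y))"
    using assms
  proof (induction G arbitrary: w)
    case Nil
    then show ?case
      using le_refl by auto
  next
    case (Cons c G)
    obtain \<Gamma> \<Delta> where c: "c = (\<Gamma> \<turnstile> \<Delta>)"
      by (cases c)
    from Cons.prems obtain v where v: "w \<preceq> v" "\<forall>A\<in>#\<Gamma>. sat h v A" "\<forall>B\<in>#\<Delta>. \<not> sat h v B"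
      "fails h v (G @ X)"
      by (auto simp: c)
    from Cons.IH[OF v(4) le_worlds[OF v(1)]] obtain u where u: "v \<preceq> u" "fails h u X"
      "\<And>h' Y. \<forall>a\<in>pars_lns G. h' a = h a \<Longrightarrow> fails h' u Y \<Longrightarrow> fails h' v (G @ Y)"
      by blast
    have "fails h' w ((c # G) @ Y)" if h': "\<forall>a\<in>pars_lns (c # G). h' a = h a" and "fails h' u Y" for h' Y
    proof -
      have "map_fm id h' A = map_fm id h A" if "A \<in># \<Gamma> \<or> A \<in># \<Delta>" for A
        using that h' by (intro map_fm_cong_pars) (auto simp: c)
      moreover have "fails h' v (G @ Y)"
        using h' \<open>fails h' u Y\<close> by (intro u(3)) (auto simp: c)
      ultimately show ?thesis
        using v by (auto simp: c)
    qed
    then show ?case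
      using le_trans v(1) u(1,2) by blast
  qed
  then show ?thesis
    using that by blast
qed

text \<open>Covers rules without eigenvariable: a chain refuting the active suffix \<open>X\<close>
  of the conclusion is turned into one for \<open>Y\<close> or \<open>Z\<close> in a premise, and
  the prefix \<open>G\<close> carries over. A rule with one premise uses it in both places.\<close>

lemma not_fails_append:
  assumes "\<not> fails h w (G @ Y)" and "\<not> fails h w (G @ Z)" and "w \<in> worlds M"
    and "\<And>u. w \<preceq> u \<Longrightarrow> fails h u X \<Longrightarrow> fails h u Y \<or> fails h u Z"
  shows "\<not> fails h w (G @ X)"
proof
  assume "fails h w (G @ X)"
  from this assms(3) obtain u where "w \<preceq> u" "fails h u X"
    and "\<And>h' Y. \<forall>a\<in>pars_lns G. h' a = h a \<Longrightarrow> fails h' u Y \<Longrightarrow> fails h' w (G @ Y)"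
    by (rule fails_appendE) blast
  then show False
    using assms(1,2,4) by blast
qed

lemma not_fails_append_succ:
  assumes "sat h w A" and "w \<in> worlds M"
  shows "\<not> fails h w (G @ (\<Gamma> \<turnstile> add_mset A \<Delta>) # H)"
proof
  assume "fails h w (G @ (\<Gamma> \<turnstile> add_mset A \<Delta>) # H)"
  from this assms(2) obtain u where "w \<preceq> u" "fails h u ((\<Gamma> \<turnstile> add_mset A \<Delta>) # H)"
    by (rule fails_appendE)
  then obtain v where "w \<preceq> v" "\<not> sat h v A"
    using le_trans by auto
  then show False
    using assms(1) forces_mono by blast
qed

lemma sat_eigen:
  assumes "a \<notin> pars_fm A"
  shows "sat (h(a := c)) w A \<longleftrightarrow> sat h w A"
proof -
  have "map_fm id (h(a := c)) A = map_fm id h A"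
    using assms by (intro map_fm_cong_pars) auto
  then show ?thesis
    by simp
qed

text \<open>Because \<open>a\<close> is fresh for \<open>A\<close>, the eigenvariable can name any
  element \<open>c\<close>, such as a counterexample found at a world of the chain.\<close>

lemma sat_inst_eigen:
  assumes "a \<notin> pars_fm A"
  shows "sat (h(a := c)) w (inst_fm a x A) \<longleftrightarrow> forces M w (inst_fm c x (map_fm id h A))"
proof -
  have "map_fm id (h(a := c)) A = map_fm id h A"
    using assms by (intro map_fm_cong_pars) auto
  then show ?thesis
    by (simp add: map_fm_inst)
qed

lemma fails_eigen: "a \<notin> pars_lns G \<Longrightarrow> fails (h(a := c)) w G \<longleftrightarrow> fails h w G"
  by (rule fails_cong) auto

text \<open>Counterpart of \<open>not_fails_append\<close> for eigenvariables. Freshness keeps the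
  prefix refuted when \<open>a\<close> takes the value \<open>c\<close>, and constant domains put
  \<open>c\<close> in the domain of \<open>w\<close>, so the induction hypothesis applies to the new
  assignment. The alternative \<open>Z\<close>, with \<open>h\<close> unchanged, serves the second
  premise of \<open>all_r2\<close>.\<close>

lemma fails_append_eigen:
  assumes "fails h w (G @ X)" and "w \<in> worlds M" and "range h \<subseteq> dmn M w" and "a \<notin> pars_lns G"
    and "\<And>u. w \<preceq> u \<Longrightarrow> fails h u X \<Longrightarrow> (\<exists>c\<in>dmn M u. fails (h(a := c)) u Y) \<or> fails h u Z"
  obtains h' where "range h' \<subseteq> dmn M w" and "fails h' w (G @ Y)" | "fails h w (G @ Z)"
proof -
  from assms(1,2) obtain u where u: "w \<preceq> u" "fails h u X"
    and G: "\<And>h' Y. \<forall>a\<in>pars_lns G. h' a = h a \<Longrightarrow> fails h' u Y \<Longrightarrow> fails h' w (G @ Y)"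
    by (rule fails_appendE) blast
  from assms(5)[OF u] show ?thesis
  proof
    assume "\<exists>c\<in>dmn M u. fails (h(a := c)) u Y"
    then obtain c where c: "c \<in> dmn M u" "fails (h(a := c)) u Y"
      by blast
    have "fails (h(a := c)) w (G @ Y)"
      using assms(4) c(2) by (intro G) auto
    moreover have "range (h(a := c)) \<subseteq> dmn M w"
      using assms(3) c(1) le_dmn[OF u(1)] by auto
    ultimately show ?thesis
      using that(1) by blast
  next
    assume "fails h u Z"
    then show ?thesis
      using G that(2) by blast
  qed
qed

text \<open>Rule induction with \<open>w\<close> and \<open>h\<close> arbitrary, since eigenvariable
  rules alter the assignment. The range condition gives every parameter a value in the domain, as
  the instances in \<open>all_l\<close> and \<open>ex_r\<close> require.\<close>

lemma not_fails:
  assumes "LNIF G" and "w \<in> worlds M" and "range h \<subseteq> dmn M w"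
  shows "\<not> fails h w G"
  using assms
proof (induction arbitrary: w h)
  case (id1 G p as \<Gamma> \<Delta> H)
  then show ?case
    by (auto elim!: fails_appendE)
next
  case (id2 G p as \<Gamma>\<^sub>1 \<Delta>\<^sub>1 H \<Gamma>\<^sub>2 \<Delta>\<^sub>2 F)
  let ?A = "Atom p (map Par as)"
  \<comment> \<open>The atom, true at the world of the earlier component, persists to the later one,
    where it would have to fail.\<close>
  have False if "fails h u ((add_mset ?A \<Gamma>\<^sub>1 \<turnstile> \<Delta>\<^sub>1) # H @ (\<Gamma>\<^sub>2 \<turnstile> add_mset ?A \<Delta>\<^sub>2) # F)" for u
  proof -
    from that obtain v where "u \<preceq> v" "sat h v ?A"
      "fails h v (H @ (\<Gamma>\<^sub>2 \<turnstile> add_mset ?A \<Delta>\<^sub>2) # F)"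
      by auto
    then show False
      using not_fails_append_succ le_worlds by blast
  qed
  then show ?case
    using id2.prems(1) by (metis fails_appendE)
next
  case (bot_l G \<Gamma> \<Delta> H)
  then show ?case
    by (auto elim!: fails_appendE)
next
  case (and_l G A B \<Gamma> \<Delta> H)
  have *: "fails h u ((add_mset A (add_mset B \<Gamma>) \<turnstile> \<Delta>) # H)"
    if "fails h u ((add_mset (And A B) \<Gamma> \<turnstile> \<Delta>) # H)" for u
    using that by auto
  show ?case
    by (rule not_fails_append[OF and_l.IH[OF and_l.prems] and_l.IH[OF and_l.prems] and_l.prems(1)])
      (rule disjI1, rule *)
next
  case (or_r G \<Gamma> A B \<Delta> H)
  have *: "fails h u ((\<Gamma> \<turnstile> add_mset A (add_mset B \<Delta>)) # H)"
    if "fails h u ((\<Gamma> \<turnstile> add_mset (Or A B) \<Delta>) # H)" for u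
    using that by auto
  show ?case
    by (rule not_fails_append[OF or_r.IH[OF or_r.prems] or_r.IH[OF or_r.prems] or_r.prems(1)])
      (rule disjI1, rule *)
next
  case (and_r G \<Gamma> A \<Delta> H B)
  have *: "fails h u ((\<Gamma> \<turnstile> add_mset A \<Delta>) # H) \<or> fails h u ((\<Gamma> \<turnstile> add_mset B \<Delta>) # H)"
    if "fails h u ((\<Gamma> \<turnstile> add_mset (And A B) \<Delta>) # H)" for u
    using that by auto
  show ?case
    by (rule not_fails_append[OF and_r.IH(1)[OF and_r.prems] and_r.IH(2)[OF and_r.prems] and_r.prems(1)])
      (rule *)
next
  case (or_l G A \<Gamma> \<Delta> H B)
  have *: "fails h u ((add_mset A \<Gamma> \<turnstile> \<Delta>) # H) \<or> fails h u ((add_mset B \<Gamma> \<turnstile> \<Delta>) # H)"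
    if "fails h u ((add_mset (Or A B) \<Gamma> \<turnstile> \<Delta>) # H)" for u
    using that by auto
  show ?case
    by (rule not_fails_append[OF or_l.IH(1)[OF or_l.prems] or_l.IH(2)[OF or_l.prems] or_l.prems(1)])
      (rule *)
next
  case (imp_r1 G \<Gamma> \<Delta> A B)
  \<comment> \<open>A world refuting the implication extends the chain by a last component.\<close>
  have *: "fails h u [\<Gamma> \<turnstile> \<Delta>, {#A#} \<turnstile> {#B#}]" if "fails h u [\<Gamma> \<turnstile> add_mset (Imp A B) \<Delta>]" for u
    using that by auto
  show ?case
    by (rule not_fails_append[OF imp_r1.IH[OF imp_r1.prems] imp_r1.IH[OF imp_r1.prems] imp_r1.prems(1)])
      (rule disjI1, rule *)
next
  case (imp_l G B \<Gamma> \<Delta> H A)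
  have *: "fails h u ((add_mset B \<Gamma> \<turnstile> \<Delta>) # H) \<or>
      fails h u ((add_mset (Imp A B) \<Gamma> \<turnstile> add_mset A \<Delta>) # H)"
    if fails: "fails h u ((add_mset (Imp A B) \<Gamma> \<turnstile> \<Delta>) # H)" for u
  proof -
    from fails obtain v where v: "u \<preceq> v" "sat h v (Imp A B)" "\<forall>C\<in>#\<Gamma>. sat h v C"
      "\<forall>C\<in>#\<Delta>. \<not> sat h v C" "fails h v H"
      by auto
    \<comment> \<open>By reflexivity the implication applies at \<open>v\<close> itself.\<close>
    then have "sat h v A \<Longrightarrow> sat h v B"
      using le_refl le_worlds by auto
    with v show ?thesis
      by (cases "sat h v A") auto
  qed
  show ?case
    by (rule not_fails_append[OF imp_l.IH(1)[OF imp_l.prems] imp_l.IH(2)[OF imp_l.prems] imp_l.prems(1)])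
      (rule *)
next
  case (lift G A \<Gamma>\<^sub>1 \<Delta>\<^sub>1 \<Gamma>\<^sub>2 \<Delta>\<^sub>2 H)
  have *: "fails h u ((add_mset A \<Gamma>\<^sub>1 \<turnstile> \<Delta>\<^sub>1) # (add_mset A \<Gamma>\<^sub>2 \<turnstile> \<Delta>\<^sub>2) # H)"
    if "fails h u ((add_mset A \<Gamma>\<^sub>1 \<turnstile> \<Delta>\<^sub>1) # (\<Gamma>\<^sub>2 \<turnstile> \<Delta>\<^sub>2) # H)" for u
    using that forces_mono by fastforce
  show ?case
    by (rule not_fails_append[OF lift.IH[OF lift.prems] lift.IH[OF lift.prems] lift.prems(1)])
      (rule disjI1, rule *)
next
  case (all_l G a x A \<Gamma> \<Delta> H)
  have *: "fails h u ((add_mset (inst_fm a x A) (add_mset (All x A) \<Gamma>) \<turnstile> \<Delta>) # H)"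
    if u: "w \<preceq> u" and fails: "fails h u ((add_mset (All x A) \<Gamma> \<turnstile> \<Delta>) # H)" for u
  proof -
    from fails obtain v where v: "u \<preceq> v" "sat h v (All x A)" "\<forall>C\<in>#\<Gamma>. sat h v C"
      "\<forall>C\<in>#\<Delta>. \<not> sat h v C" "fails h v H"
      by auto
    \<comment> \<open>Constant domains carry the value of \<open>a\<close> from \<open>w\<close> up
      to \<open>v\<close>.\<close>
    have "h a \<in> dmn M v"
      using all_l.prems u v(1) le_dmn by auto
    then have "sat h v (inst_fm a x A)"
      using v(1,2) le_refl le_worlds by (auto simp: map_fm_inst)
    with v show ?thesis
      by auto
  qed
  show ?case
    by (rule not_fails_append[OF all_l.IH[OF all_l.prems] all_l.IH[OF all_l.prems] all_l.prems(1)])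
      (rule disjI1, rule *)
next
  case (all_r1 G \<Gamma> \<Delta> a x A)
  let ?Y = "[\<Gamma> \<turnstile> \<Delta>, {#} \<turnstile> {#inst_fm a x A#}]"
  have a: "a \<notin> pars_fm A" "a \<notin> pars_lns [\<Gamma> \<turnstile> \<Delta>]" "a \<notin> pars_lns G"
    using all_r1.hyps by (auto split: if_splits)
  have *: "\<exists>c\<in>dmn M u. fails (h(a := c)) u ?Y"
    if "w \<preceq> u" and fails: "fails h u [\<Gamma> \<turnstile> add_mset (All x A) \<Delta>]" for u
  proof -
    \<comment> \<open>The world \<open>v\<close> extends the chain, and \<open>c\<close>, which
      falsifies the instance there, becomes the value of the eigenvariable.\<close>
    from fails obtain u\<^sub>1 v c where u\<^sub>1: "u \<preceq> u\<^sub>1" "\<forall>C\<in>#\<Gamma>. sat h u\<^sub>1 C" "\<forall>C\<in>#\<Delta>. \<not> sat h u\<^sub>1 C"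
      and v: "u\<^sub>1 \<preceq> v" "c \<in> dmn M v" "\<not> forces M v (inst_fm c x (map_fm id h A))"
      by auto
    have "fails (h(a := c)) u ?Y"
      using u\<^sub>1 v a by (auto simp: sat_inst_eigen sat_eigen simp del: fun_upd_apply)
    moreover have "c \<in> dmn M u"
      using u\<^sub>1(1) v(1,2) le_dmn by auto
    ultimately show ?thesis
      by blast
  qed
  show ?case
  proof
    assume "fails h w (G @ [\<Gamma> \<turnstile> add_mset (All x A) \<Delta>])"
    then consider h' where "range h' \<subseteq> dmn M w" "fails h' w (G @ ?Y)" | "fails h w (G @ ?Y)"
      using all_r1.prems a(3) disjI1[OF *] by (rule fails_append_eigen)
    then show False
      using all_r1.IH all_r1.prems by cases blast+
  qed
next
  case (ex_l G a x A \<Gamma> \<Delta> H)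
  let ?Y = "(add_mset (inst_fm a x A) \<Gamma> \<turnstile> \<Delta>) # H"
  have a: "a \<notin> pars_fm A" "a \<notin> pars_lns [\<Gamma> \<turnstile> \<Delta>]" "a \<notin> pars_lns H" "a \<notin> pars_lns G"
    using ex_l.hyps by auto
  have *: "\<exists>c\<in>dmn M u. fails (h(a := c)) u ?Y"
    if "w \<preceq> u" and fails: "fails h u ((add_mset (Ex x A) \<Gamma> \<turnstile> \<Delta>) # H)" for u
  proof -
    \<comment> \<open>The existential witness \<open>c\<close> becomes the value of
      \<open>a\<close>; as \<open>a\<close> is absent from the other formulae and from
      \<open>H\<close>, the chain survives.\<close>
    from fails obtain v c where v: "u \<preceq> v" "\<forall>C\<in>#\<Gamma>. sat h v C" "\<forall>C\<in>#\<Delta>. \<not> sat h v C" "fails h v H"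
      and c: "c \<in> dmn M v" "forces M v (inst_fm c x (map_fm id h A))"
      by auto
    have "fails (h(a := c)) u ?Y"
      using v c a by (auto simp: sat_inst_eigen sat_eigen fails_eigen simp del: fun_upd_apply)
    moreover have "c \<in> dmn M u"
      using v(1) c(1) le_dmn by auto
    ultimately show ?thesis
      by blast
  qed
  show ?case
  proof
    assume "fails h w (G @ (add_mset (Ex x A) \<Gamma> \<turnstile> \<Delta>) # H)"
    then consider h' where "range h' \<subseteq> dmn M w" "fails h' w (G @ ?Y)" | "fails h w (G @ ?Y)"
      using ex_l.prems a(4) disjI1[OF *] by (rule fails_append_eigen)
    then show False
      using ex_l.IH ex_l.prems by cases blast+
  qed
next
  case (ex_r G \<Gamma> a x A \<Delta> H)
  have *: "fails h u ((\<Gamma> \<turnstile> add_mset (inst_fm a x A) (add_mset (Ex x A) \<Delta>)) # H)"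
    if u: "w \<preceq> u" and fails: "fails h u ((\<Gamma> \<turnstile> add_mset (Ex x A) \<Delta>) # H)" for u
  proof -
    from fails obtain v where v: "u \<preceq> v" "\<not> sat h v (Ex x A)" "\<forall>C\<in>#\<Gamma>. sat h v C"
      "\<forall>C\<in>#\<Delta>. \<not> sat h v C" "fails h v H"
      by auto
    have "h a \<in> dmn M v"
      using ex_r.prems u v(1) le_dmn by auto
    then have "\<not> sat h v (inst_fm a x A)"
      using v(2) by (auto simp: map_fm_inst)
    with v show ?thesis
      by auto
  qed
  show ?case
    by (rule not_fails_append[OF ex_r.IH[OF ex_r.prems] ex_r.IH[OF ex_r.prems] ex_r.prems(1)])
      (rule disjI1, rule *)
next
  case (imp_r2 G \<Gamma>\<^sub>1 \<Delta>\<^sub>1 A B \<Gamma>\<^sub>2 \<Delta>\<^sub>2 H)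
  have *: "fails h u ((\<Gamma>\<^sub>1 \<turnstile> \<Delta>\<^sub>1) # ({#A#} \<turnstile> {#B#}) # (\<Gamma>\<^sub>2 \<turnstile> \<Delta>\<^sub>2) # H) \<or>
      fails h u ((\<Gamma>\<^sub>1 \<turnstile> \<Delta>\<^sub>1) # (\<Gamma>\<^sub>2 \<turnstile> add_mset (Imp A B) \<Delta>\<^sub>2) # H)"
    if fails: "fails h u ((\<Gamma>\<^sub>1 \<turnstile> add_mset (Imp A B) \<Delta>\<^sub>1) # (\<Gamma>\<^sub>2 \<turnstile> \<Delta>\<^sub>2) # H)" for u
  proof -
    from fails obtain u\<^sub>1 u\<^sub>2 v where
      u\<^sub>1: "u \<preceq> u\<^sub>1" "\<forall>C\<in>#\<Gamma>\<^sub>1. sat h u\<^sub>1 C" "\<forall>C\<in>#\<Delta>\<^sub>1. \<not> sat h u\<^sub>1 C" and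
      u\<^sub>2: "u\<^sub>1 \<preceq> u\<^sub>2" "\<forall>C\<in>#\<Gamma>\<^sub>2. sat h u\<^sub>2 C" "\<forall>C\<in>#\<Delta>\<^sub>2. \<not> sat h u\<^sub>2 C" "fails h u\<^sub>2 H" and
      v: "u\<^sub>1 \<preceq> v" "sat h v A" "\<not> sat h v B"
      by auto
    from le_connected[OF v(1) u\<^sub>2(1)] show ?thesis
    proof
      assume "v \<preceq> u\<^sub>2"
      then have "fails h u ((\<Gamma>\<^sub>1 \<turnstile> \<Delta>\<^sub>1) # ({#A#} \<turnstile> {#B#}) # (\<Gamma>\<^sub>2 \<turnstile> \<Delta>\<^sub>2) # H)"
        using u\<^sub>1 u\<^sub>2 v by auto
      then show ?thesis ..
    next
      assume "u\<^sub>2 \<preceq> v"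
      then have "\<not> sat h u\<^sub>2 (Imp A B)"
        using v by auto
      then have "fails h u ((\<Gamma>\<^sub>1 \<turnstile> \<Delta>\<^sub>1) # (\<Gamma>\<^sub>2 \<turnstile> add_mset (Imp A B) \<Delta>\<^sub>2) # H)"
        using u\<^sub>1 u\<^sub>2 by auto
      then show ?thesis ..
    qed
  qed
  show ?case
    by (rule not_fails_append[OF imp_r2.IH(1)[OF imp_r2.prems] imp_r2.IH(2)[OF imp_r2.prems] imp_r2.prems(1)])
      (rule *)
next
  case (all_r2 G \<Gamma>\<^sub>1 \<Delta>\<^sub>1 a x A \<Gamma>\<^sub>2 \<Delta>\<^sub>2 H)
  let ?X = "(\<Gamma>\<^sub>1 \<turnstile> add_mset (All x A) \<Delta>\<^sub>1) # (\<Gamma>\<^sub>2 \<turnstile> \<Delta>\<^sub>2) # H"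
  let ?Y = "(\<Gamma>\<^sub>1 \<turnstile> \<Delta>\<^sub>1) # ({#} \<turnstile> {#inst_fm a x A#}) # (\<Gamma>\<^sub>2 \<turnstile> \<Delta>\<^sub>2) # H"
  let ?Z = "(\<Gamma>\<^sub>1 \<turnstile> \<Delta>\<^sub>1) # (\<Gamma>\<^sub>2 \<turnstile> add_mset (All x A) \<Delta>\<^sub>2) # H"
  have a: "a \<notin> pars_fm A" "a \<notin> pars_lns [\<Gamma>\<^sub>1 \<turnstile> \<Delta>\<^sub>1, \<Gamma>\<^sub>2 \<turnstile> \<Delta>\<^sub>2]" "a \<notin> pars_lns H" "a \<notin> pars_lns G"
    using all_r2.hyps by auto
  have *: "(\<exists>c\<in>dmn M u. fails (h(a := c)) u ?Y) \<or> fails h u ?Z"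
    if "w \<preceq> u" and fails: "fails h u ?X" for u
  proof -
    from fails obtain u\<^sub>1 u\<^sub>2 v c where
      u\<^sub>1: "u \<preceq> u\<^sub>1" "\<forall>C\<in>#\<Gamma>\<^sub>1. sat h u\<^sub>1 C" "\<forall>C\<in>#\<Delta>\<^sub>1. \<not> sat h u\<^sub>1 C" and
      u\<^sub>2: "u\<^sub>1 \<preceq> u\<^sub>2" "\<forall>C\<in>#\<Gamma>\<^sub>2. sat h u\<^sub>2 C" "\<forall>C\<in>#\<Delta>\<^sub>2. \<not> sat h u\<^sub>2 C" "fails h u\<^sub>2 H" and
      v: "u\<^sub>1 \<preceq> v" "c \<in> dmn M v" "\<not> forces M v (inst_fm c x (map_fm id h A))"
      by auto
    from le_connected[OF v(1) u\<^sub>2(1)] show ?thesis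
    proof
      assume "v \<preceq> u\<^sub>2"
      then have "fails (h(a := c)) u ?Y"
        using u\<^sub>1 u\<^sub>2 v a
        by (auto simp: sat_inst_eigen sat_eigen fails_eigen simp del: fun_upd_apply)
      moreover have "c \<in> dmn M u"
        using u\<^sub>1(1) v(1,2) le_dmn by auto
      ultimately show ?thesis
        by blast
    next
      \<comment> \<open>Here the quantified formula itself moves to the next component, so the
        assignment stays as it is.\<close>
      assume "u\<^sub>2 \<preceq> v"
      then have "\<not> sat h u\<^sub>2 (All x A)"
        using v by auto
      then have "fails h u ?Z"
        using u\<^sub>1 u\<^sub>2 by auto
      then show ?thesis ..
    qed
  qed
  show ?case
  proof
    assume "fails h w (G @ ?X)"
    then consider h' where "range h' \<subseteq> dmn M w" "fails h' w (G @ ?Y)" | "fails h w (G @ ?Z)"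
      using all_r2.prems a(4) * by (rule fails_append_eigen)
    then show False
      using all_r2.IH all_r2.prems by cases blast+
  qed
qed

section \<open>Interpretation of sequents and universal closure\<close>

lemma forces_conj_list: "forces M w (conj_list As) \<longleftrightarrow> (\<forall>A\<in>set As. forces M w A)"
  by (induction As rule: conj_list.induct) (auto simp: Top_def)

lemma forces_disj_list: "forces M w (disj_list As) \<longleftrightarrow> (\<exists>A\<in>set As. forces M w A)"
  by (induction As rule: disj_list.induct) auto

lemma map_conj_list: "map_fm f h (conj_list As) = conj_list (map (map_fm f h) As)"
  by (induction As rule: conj_list.induct) (auto simp: Top_def)

lemma map_disj_list: "map_fm f h (disj_list As) = disj_list (map (map_fm f h) As)"
  by (induction As rule: disj_list.induct) auto

lemma sat_big_conj: "sat h w (big_conj \<Gamma>) \<longleftrightarrow> (\<forall>A\<in>#\<Gamma>. sat h w A)"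
  by (simp add: big_conj_def map_conj_list forces_conj_list set_some_list)

lemma sat_big_disj: "sat h w (big_disj \<Gamma>) \<longleftrightarrow> (\<exists>A\<in>#\<Gamma>. sat h w A)"
  by (simp add: big_disj_def map_disj_list forces_disj_list set_some_list)

text \<open>A world refuting the outer implication is the next link of the chain; the disjunct for
  the remaining components fails there too, which is the recursion of \<open>fails\<close>.\<close>

lemma sat_interp: "G \<noteq> [] \<Longrightarrow> sat h w (interp G) \<longleftrightarrow> \<not> fails h w G"
  by (induction G arbitrary: w rule: interp.induct) (auto simp: sat_big_conj sat_big_disj)

text \<open>\<open>S\<close> holds the parameters whose values must lie in the domain. The
  quantifier itself supplies such a value for \<open>a\<close>, which therefore drops out; the other
  values remain in the domain above \<open>w\<close> by constancy.\<close>

lemma sat_all_par: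
  assumes A: "\<And>w h. w \<in> worlds M \<Longrightarrow> h ` S \<subseteq> dmn M w \<Longrightarrow> sat h w A"
    and w: "w \<in> worlds M" and h: "h ` (S - {a}) \<subseteq> dmn M w"
  shows "sat h w (all_par a A)"
proof -
  define x where "x = (LEAST x. x \<notin> vars_fm A)"
  have "forces M u (inst_fm c x (map_fm id h (gen_fm a x A)))" if "w \<preceq> u" "c \<in> dmn M u" for u c
  proof -
    have "sat (h(a := c)) u A"
      using that h le_dmn[OF that(1)] le_worlds[OF that(1)] by (intro A) auto
    then show ?thesis
      using fresh_var[of A] by (simp add: inst_map_gen x_def)
  qed
  then show ?thesis
    by (simp add: all_par_def Let_def flip: x_def)
qed

text \<open>Each quantifier removes one condition on \<open>h\<close>; once the list covers
  \<open>S\<close>, none remains.\<close>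

lemma sat_foldr_all_par:
  assumes "\<And>w h. w \<in> worlds M \<Longrightarrow> h ` S \<subseteq> dmn M w \<Longrightarrow> sat h w A"
    and "w \<in> worlds M" and "h ` (S - set ps) \<subseteq> dmn M w"
  shows "sat h w (foldr all_par ps A)"
  using assms(2,3)
proof (induction ps arbitrary: w h)
  case Nil
  then show ?case
    using assms(1)[of w h] by (simp add: id_def)
next
  case (Cons p ps)
  have "S - set (p # ps) = S - set ps - {p}"
    by auto
  then show ?case
    unfolding foldr.simps o_apply
    using Cons.prems by (intro sat_all_par[where S = "S - set ps"] Cons.IH) simp_all
qed

text \<open>Every parameter of \<open>A\<close> gets quantified, so \<open>h\<close> is
  unconstrained in the conclusion and may even take values outside the domain.\<close>

lemma sat_univ_closure:
  assumes "fv_fm A = {}"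
    and A: "\<And>w h. w \<in> worlds M \<Longrightarrow> range h \<subseteq> dmn M w \<Longrightarrow> sat h w A"
    and w: "w \<in> worlds M"
  shows "sat h w (univ_closure A)"
proof -
  have "sat g u A" if u: "u \<in> worlds M" and g: "g ` pars_fm A \<subseteq> dmn M u" for u g
  proof -
    \<comment> \<open>The hypothesis on \<open>A\<close> wants all values in the domain, whereas
      \<open>g\<close> is controlled only on the parameters of \<open>A\<close>; the others receive
      the default \<open>d\<close>.\<close>
    obtain d where "d \<in> dmn M u"
      using dmn_nonempty[OF u] by blast
    then have "sat (\<lambda>a. if a \<in> pars_fm A then g a else d) u A"
      using u g by (intro A) auto
    also have "map_fm id (\<lambda>a. if a \<in> pars_fm A then g a else d) A = map_fm id g A"
      by (rule map_fm_cong_pars) simp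
    finally show ?thesis .
  qed
  then have "sat h w (foldr all_par (sorted_list_of_set (pars_fm A)) A)"
    by (rule sat_foldr_all_par) (use w in \<open>auto simp: finite_pars_fm\<close>)
  then show ?thesis
    using assms(1) by (simp add: univ_closure_closed)
qed

end

theorem theorem2:
  fixes ar :: "'p \<Rightarrow> nat" and G :: "'p lns"
  assumes "is_lns ar G"
    and "LNIF G"
  shows "valid TYPE('w) TYPE('d) ar (univ_closure (interp G))"
  unfolding valid_def
proof (intro allI impI ballI)
  fix M :: "('w, 'd, 'p) model" and w
  assume "is_model ar M" and w: "w \<in> worlds M"
  then interpret lin_model ar M
    by unfold_locales
  have fv: "fv_fm (interp G) = {}"
    using assms(1) by (auto simp: is_lns_def fv_interp)
  have "sat h u (interp G)" if "u \<in> worlds M" "range h \<subseteq> dmn M u" for u h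
    using assms that by (simp add: is_lns_def sat_interp not_fails)
  \<comment> \<open>\<open>valid\<close> forms a closure of its own, so the formula is closed twice.
    That the first closure is forced under all assignments is the hypothesis for the second, which
    then admits the constant assignment \<open>undefined\<close>.\<close>
  then have "sat h u (univ_closure (interp G))" if "u \<in> worlds M" for u h
    using sat_univ_closure[OF fv] that by blast
  then show "sat (\<lambda>_. undefined) w (univ_closure (univ_closure (interp G)))"
    using sat_univ_closure[OF fv_univ_closure[OF fv]] w by blast
qed

end
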